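(* Let $(X_i)_{i\in\Gamma}$ be a family of Banach spaces and let $X=\oplus_{c_0(\Gamma)}X_i$. If $X$ has $BDP$ (respectively $BHP$, $BSCSP$), then each $X_i$, $i\in\Gamma$, has $BDP$ (respectively $BHP$, $BSCSP$).
   Context: Banach spaces $X_i$ are real and nontrivial; $B_X$ is the closed unit ball of $X$. $\oplus_{c_0(\Gamma)}X_i$ is the space of families $(x_i)_{i\in\Gamma}$, $x_i\in X_i$, such that for every $\varepsilon>0$ the set $\{i:\|x_i\|\ge\varepsilon\}$ is finite, with norm $\sup_i\|x_i\|$. A slice of $B_X$ is a set $S(B_X,x^*,\alpha)=\{x\in B_X: x^*(x)>\sup x^*(B_X)-\alpha\}$ with $x^*\in X^*$, $\|x^*\|=1$, $\alpha>0$. A convex combination of slices of $B_X$ is a set $\sum_{i=1}^n\lambda_i S_i=\{\sum_{i=1}^n\lambda_i s_i: s_i\in S_i\}$ where each $S_i$ is a slice of $B_X$, $0\le\lambda_i\le 1$ and $\sum_{i=1}^n\lambda_i=1$. A Banach space $X$ has: the Ball Dentable Property ($BDP$) if $B_X$ has slices of arbitrarily small diameter; the Ball Huskable Property ($BHP$) if $B_X$ has nonempty relatively weakly open subsets of arbitrarily small diameter; the Ball Small Combination of Slice Property ($BSCSP$) if $B_X$ has convex combinations of slices of arbitrarily small diameter. ("Arbitrarily small" means: for every $\varepsilon>0$ there is one of diameter less than $\varepsilon$.) *)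

theory Defs
  imports "HOL-Analysis.Analysis" "HOL-Algebra.Module"
begin

text \<open>
  The members of a family of Banach spaces are in general of different nature, so a Banach space
  is a structure with an explicit carrier: a module over the reals (in the sense of
  \<^theory>\<open>HOL-Algebra.Module\<close>) together with a norm. The fields \<^const>\<open>mult\<close> and \<^const>\<open>one\<close>, which
  the module record inherits from the ring record, play no role.
\<close>

definition real_scalars :: "real ring" where
  "real_scalars = \<lparr>carrier = UNIV, mult = (*), one = 1, zero = 0, add = (+)\<rparr>"

record 'a normed_module = "(real, 'a) module" +
  nrm :: "'a \<Rightarrow> real"

definition ndist :: "('a, 'm) normed_module_scheme \<Rightarrow> 'a \<Rightarrow> 'a \<Rightarrow> real" where
  "ndist V x y = nrm V (x \<ominus>\<^bsub>V\<^esub> y)"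

locale real_normed_space = module real_scalars V for V (structure) +
  assumes nrm_eq_zero: "x \<in> carrier V \<Longrightarrow> nrm V x = 0 \<longleftrightarrow> x = \<zero>"
    and nrm_triangle: "\<lbrakk>x \<in> carrier V; y \<in> carrier V\<rbrakk> \<Longrightarrow> nrm V (x \<oplus> y) \<le> nrm V x + nrm V y"
    and nrm_smult: "x \<in> carrier V \<Longrightarrow> nrm V (a \<odot> x) = \<bar>a\<bar> * nrm V x"

locale banach_space = real_normed_space +
  assumes complete: "Metric_space.mcomplete (carrier V) (ndist V)"

definition unit_ball :: "('a, 'm) normed_module_scheme \<Rightarrow> 'a set" where
  "unit_ball V = {x \<in> carrier V. nrm V x \<le> 1}"

text \<open>
  Functionals are functions on the whole type, of which only the values on the carrier matter.
\<close>

definition dual :: "('a, 'm) normed_module_scheme \<Rightarrow> ('a \<Rightarrow> real) set" where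
  "dual V = {f. (\<forall>x\<in>carrier V. \<forall>y\<in>carrier V. f (x \<oplus>\<^bsub>V\<^esub> y) = f x + f y) \<and>
                (\<forall>a. \<forall>x\<in>carrier V. f (a \<odot>\<^bsub>V\<^esub> x) = a * f x) \<and>
                (\<exists>K. \<forall>x\<in>carrier V. \<bar>f x\<bar> \<le> K * nrm V x)}"

definition dual_norm :: "('a, 'm) normed_module_scheme \<Rightarrow> ('a \<Rightarrow> real) \<Rightarrow> real" where
  "dual_norm V f = (SUP x\<in>unit_ball V. \<bar>f x\<bar>)"

definition weak_topology :: "('a, 'm) normed_module_scheme \<Rightarrow> 'a topology" where
  "weak_topology V =
     topology_generated_by {{x \<in> carrier V. f x \<in> U} | f U. f \<in> dual V \<and> open U}"

text \<open>The analogue of \<^const>\<open>diameter\<close> for subsets of a carrier.\<close>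

definition diam :: "('a, 'm) normed_module_scheme \<Rightarrow> 'a set \<Rightarrow> real" where
  "diam V S = (if S = {} then 0 else SUP (x, y)\<in>S \<times> S. ndist V x y)"

definition slice :: "('a, 'm) normed_module_scheme \<Rightarrow> ('a \<Rightarrow> real) \<Rightarrow> real \<Rightarrow> 'a set" where
  "slice V f \<alpha> = {x \<in> unit_ball V. f x > (SUP y\<in>unit_ball V. f y) - \<alpha>}"

definition is_slice :: "('a, 'm) normed_module_scheme \<Rightarrow> 'a set \<Rightarrow> bool" where
  "is_slice V S \<longleftrightarrow> (\<exists>f \<alpha>. f \<in> dual V \<and> dual_norm V f = 1 \<and> \<alpha> > 0 \<and> S = slice V f \<alpha>)"

definition is_convex_comb_of_slices :: "('a, 'm) normed_module_scheme \<Rightarrow> 'a set \<Rightarrow> bool" where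
  "is_convex_comb_of_slices V C \<longleftrightarrow>
     (\<exists>(n::nat) (l::nat \<Rightarrow> real) (S::nat \<Rightarrow> 'a set).
        (\<forall>k\<in>{1..n}. is_slice V (S k) \<and> 0 \<le> l k \<and> l k \<le> 1) \<and> (\<Sum>k=1..n. l k) = 1 \<and>
        C = {(\<Oplus>\<^bsub>V\<^esub>k\<in>{1..n}. l k \<odot>\<^bsub>V\<^esub> s k) | s. \<forall>k\<in>{1..n}. s k \<in> S k})"

definition BDP :: "('a, 'm) normed_module_scheme \<Rightarrow> bool" where
  "BDP V \<longleftrightarrow> (\<forall>\<epsilon>>0. \<exists>S. is_slice V S \<and> diam V S < \<epsilon>)"

definition BHP :: "('a, 'm) normed_module_scheme \<Rightarrow> bool" where
  "BHP V \<longleftrightarrow> (\<forall>\<epsilon>>0. \<exists>W. openin (subtopology (weak_topology V) (unit_ball V)) W \<and>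
                        W \<noteq> {} \<and> diam V W < \<epsilon>)"

definition BSCSP :: "('a, 'm) normed_module_scheme \<Rightarrow> bool" where
  "BSCSP V \<longleftrightarrow> (\<forall>\<epsilon>>0. \<exists>C. is_convex_comb_of_slices V C \<and> diam V C < \<epsilon>)"

text \<open>
  The zero inserted in the supremum only matters for the empty index set; the norms
  of the summands are nonnegative.
\<close>

definition c0_sum :: "'i set \<Rightarrow> ('i \<Rightarrow> ('a, 'm) normed_module_scheme) \<Rightarrow> ('i \<Rightarrow> 'a) normed_module" where
  "c0_sum \<Gamma> X =
     \<lparr>carrier = {x \<in> (\<Pi>\<^sub>E i\<in>\<Gamma>. carrier (X i)). \<forall>\<epsilon>>0. finite {i \<in> \<Gamma>. nrm (X i) (x i) \<ge> \<epsilon>}},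
      mult = undefined, one = undefined,
      zero = (\<lambda>i\<in>\<Gamma>. \<zero>\<^bsub>X i\<^esub>),
      add = (\<lambda>x y. \<lambda>i\<in>\<Gamma>. x i \<oplus>\<^bsub>X i\<^esub> y i),
      smult = (\<lambda>a x. \<lambda>i\<in>\<Gamma>. a \<odot>\<^bsub>X i\<^esub> x i),
      nrm = (\<lambda>x. Sup (insert 0 ((\<lambda>i. nrm (X i) (x i)) ` \<Gamma>)))\<rparr>"

end

theory Submission
  imports Defs
begin

text \<open>
  Fix a coordinate \<open>i\<close> and let \<open>J\<close> embed \<open>X i\<close> into the sum \<open>W\<close> as the \<open>i\<close>-th coordinate. Because
  the norm of \<open>W\<close> is a supremum, a point \<open>w\<close> of the unit ball stays in the unit ball when its
  \<open>i\<close>-th coordinate is replaced by any other point of the unit ball of \<open>X i\<close>. So the unit ball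
  of \<open>W\<close> is a union of translates \<open>J(B) + z\<close> of the embedded unit ball \<open>B\<close> of \<open>X i\<close>. This
  property of the linear isometry \<open>J\<close> carries the whole proof; it is isolated in the locale
  \<open>ball_translate_embedding\<close>, and \<open>ball_translate_embedding_coord\<close> establishes it for the sum.

  Given a set \<open>S\<close> in the unit ball of \<open>W\<close> and a point of \<open>S\<close> in such a translate, look at the fibre
  \<open>{x \<in> B. J x + z \<in> S}\<close>. It is nonempty, and its diameter is at most that of \<open>S\<close>, because
  \<open>x \<mapsto> J x + z\<close> is an isometry. This map is affine and weakly continuous, so the fibre of a relatively
  weakly open set is again one, which settles the huskable case. For a functional \<open>f\<close>, the fibre
  of a slice by \<open>f\<close> is cut out by \<open>f \<circ> J\<close>. It is therefore a slice, except that it is all of \<open>B\<close>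
  when \<open>f \<circ> J = 0\<close> (lemma \<open>slice_fibre\<close>). As \<open>X i\<close> is nontrivial, \<open>B\<close> has diameter at least \<open>2\<close>, so this exception cannot
  occur for a slice of diameter less than \<open>2\<close>.

  For a convex combination of slices, take fibres in each slice separately; the weighted sum of
  the fibres is mapped into the combination by \<open>x \<mapsto> J x + z\<close>, where \<open>z\<close> is the weighted sum of the
  translation vectors. If all fibres are \<open>B\<close>, the combination contains a translate of \<open>J(B)\<close> and has
  diameter at least \<open>2\<close>. Otherwise some fibre is a slice, and every fibre equal to \<open>B\<close> may be shrunk
  to that slice.
\<close>

section \<open>Real normed spaces with explicit carrier\<close>

lemma real_scalars_simps [simp]:
  "carrier real_scalars = UNIV" "x \<otimes>\<^bsub>real_scalars\<^esub> y = x * y" "\<one>\<^bsub>real_scalars\<^esub> = 1"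
  "\<zero>\<^bsub>real_scalars\<^esub> = 0" "x \<oplus>\<^bsub>real_scalars\<^esub> y = x + y"
  by (simp_all add: real_scalars_def)

context real_normed_space
begin

lemma smult_mem [simp, intro]: "x \<in> carrier V \<Longrightarrow> a \<odot> x \<in> carrier V"
  using smult_closed by simp

lemma smult_distrib_left: "x \<in> carrier V \<Longrightarrow> (a + b) \<odot> x = a \<odot> x \<oplus> b \<odot> x"
  using smult_l_distr[of a b x] by simp

lemma smult_distrib_right:
  "\<lbrakk>x \<in> carrier V; y \<in> carrier V\<rbrakk> \<Longrightarrow> a \<odot> (x \<oplus> y) = a \<odot> x \<oplus> a \<odot> y"
  using smult_r_distr[of a x y] by simp

lemma smult_assoc: "x \<in> carrier V \<Longrightarrow> (a * b) \<odot> x = a \<odot> (b \<odot> x)"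
  using smult_assoc1[of a b x] by simp

lemma smult_1 [simp]: "x \<in> carrier V \<Longrightarrow> 1 \<odot> x = x"
  using smult_one[of x] by simp

lemma smult_0 [simp]: "x \<in> carrier V \<Longrightarrow> 0 \<odot> x = \<zero>"
  using smult_l_null[of x] by simp

lemma smult_minus_1: 
  assumes "x \<in> carrier V"
  shows "(-1) \<odot> x = \<ominus> x"
proof -
  have "(-1) \<odot> x \<oplus> x = (-1) \<odot> x \<oplus> 1 \<odot> x"
    using assms by simp
  also have "\<dots> = \<zero>"
    using assms smult_distrib_left[of x "-1" 1] by simp
  finally show ?thesis
    using assms M.minus_equality by auto
qed

lemma nrm_zero [simp]: "nrm V \<zero> = 0"
  using nrm_eq_zero by simp

lemma nrm_minus: "x \<in> carrier V \<Longrightarrow> nrm V (\<ominus> x) = nrm V x"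
  using nrm_smult[of x "-1"] smult_minus_1[of x] by simp

lemma nrm_nonneg: 
  assumes "x \<in> carrier V"
  shows "0 \<le> nrm V x"
  using nrm_triangle[of x "\<ominus> x"] nrm_minus[of x] assms by (simp add: M.r_neg)

lemma ndist_le:
  "\<lbrakk>x \<in> carrier V; y \<in> carrier V\<rbrakk> \<Longrightarrow> ndist V x y \<le> nrm V x + nrm V y"
  using nrm_triangle[of x "\<ominus> y"] nrm_minus[of y] by (simp add: ndist_def a_minus_def)

lemma ndist_self: "x \<in> carrier V \<Longrightarrow> ndist V x x = 0"
  by (simp add: ndist_def a_minus_def M.r_neg)

lemma zero_mem_unit_ball: "\<zero> \<in> unit_ball V"
  by (simp add: unit_ball_def)

lemma finsum_smult_left:
  assumes "finite A" "x \<in> carrier V"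
  shows "(\<Oplus>k\<in>A. l k \<odot> x) = sum l A \<odot> x"
  using assms by (induction A rule: finite_induct) (simp_all add: Pi_def smult_distrib_left)

lemma finsum_smult_mem:
  "(\<And>k. k \<in> A \<Longrightarrow> s k \<in> carrier V) \<Longrightarrow> (\<Oplus>k\<in>A. l k \<odot> s k) \<in> carrier V"
  by (intro M.finsum_closed) auto

lemma nrm_finsum_smult_le:
  assumes "finite A" "\<And>k. k \<in> A \<Longrightarrow> s k \<in> unit_ball V" "\<And>k. k \<in> A \<Longrightarrow> 0 \<le> l k"
  shows "nrm V (\<Oplus>k\<in>A. l k \<odot> s k) \<le> sum l A"
  using assms
proof (induction A rule: finite_induct)
  case (insert k A)
  have carr: "s j \<in> carrier V" if "j \<in> insert k A" for j
    using insert.prems(1)[OF that] by (simp add: unit_ball_def)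
  have "nrm V (\<Oplus>j\<in>insert k A. l j \<odot> s j) = nrm V (l k \<odot> s k \<oplus> (\<Oplus>j\<in>A. l j \<odot> s j))"
    using insert.hyps carr by (subst M.finsum_insert) auto
  also have "\<dots> \<le> nrm V (l k \<odot> s k) + nrm V (\<Oplus>j\<in>A. l j \<odot> s j)"
    using carr by (intro nrm_triangle finsum_smult_mem) auto
  also have "nrm V (l k \<odot> s k) \<le> l k"
    using insert.prems(1)[of k] insert.prems(2)[of k]
    by (simp add: nrm_smult unit_ball_def mult_left_le)
  also have "nrm V (\<Oplus>j\<in>A. l j \<odot> s j) \<le> sum l A"
    using insert by simp
  finally show ?case
    using insert.hyps by simp
qed simp

text \<open>The real supremum that defines \<^const>\<open>diam\<close> is only meaningful for bounded sets of distances;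
  the sets in question all lie in the unit ball.\<close>

lemma ball_diam:
  assumes "S \<subseteq> unit_ball V"
  shows bdd_above_ndist: "bdd_above ((\<lambda>(x, y). ndist V x y) ` (S \<times> S))"
    and ndist_le_diam: "\<And>x y. x \<in> S \<Longrightarrow> y \<in> S \<Longrightarrow> ndist V x y \<le> diam V S"
    and diam_nonneg: "0 \<le> diam V S"
proof -
  have "ndist V x y \<le> 2" if "x \<in> S" "y \<in> S" for x y
  proof -
    have "x \<in> carrier V" "y \<in> carrier V" "nrm V x \<le> 1" "nrm V y \<le> 1"
      using that assms by (auto simp: unit_ball_def)
    with ndist_le[of x y] show ?thesis by simp
  qed
  then show bdd: "bdd_above ((\<lambda>(x, y). ndist V x y) ` (S \<times> S))"
    by (intro bdd_aboveI2[where M = 2]) auto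
  show le: "ndist V x y \<le> diam V S" if "x \<in> S" "y \<in> S" for x y
    using cSUP_upper[OF _ bdd, of "(x, y)"] that by (auto simp: diam_def)
  show "0 \<le> diam V S"
  proof (cases "S = {}")
    case False
    then obtain x where "x \<in> S" by blast
    with le[of x x] assms show ?thesis
      by (auto simp: ndist_self unit_ball_def)
  qed (simp add: diam_def)
qed

lemma diam_unit_ball:
  assumes "carrier V \<noteq> {\<zero>}"
  shows "2 \<le> diam V (unit_ball V)"
proof -
  obtain x where x: "x \<in> carrier V" "x \<noteq> \<zero>"
    using assms M.zero_closed by blast
  define u where "u = (1 / nrm V x) \<odot> x"
  have pos: "nrm V x > 0"
    using x nrm_eq_zero[of x] nrm_nonneg[of x] by linarith
  have u: "u \<in> carrier V" "nrm V u = 1"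
    using x pos by (auto simp: u_def nrm_smult)
  have "u \<ominus> \<ominus> u = 1 \<odot> u \<oplus> 1 \<odot> u"
    using u by (simp add: a_minus_def)
  also have "\<dots> = 2 \<odot> u"
    using u smult_distrib_left[of u 1 1] by simp
  finally have "ndist V u (\<ominus> u) = 2"
    using u by (simp add: ndist_def nrm_smult)
  moreover have "u \<in> unit_ball V" "\<ominus> u \<in> unit_ball V"
    using u by (auto simp: unit_ball_def nrm_minus)
  ultimately show ?thesis
    using ndist_le_diam[of "unit_ball V" u "\<ominus> u"] by simp
qed

lemma dual_bdd:
  assumes "f \<in> dual V"
  shows bdd_above_dual: "bdd_above (f ` unit_ball V)"
    and bdd_above_abs_dual: "bdd_above ((\<lambda>x. \<bar>f x\<bar>) ` unit_ball V)"
proof -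
  obtain K where K: "\<And>x. x \<in> carrier V \<Longrightarrow> \<bar>f x\<bar> \<le> K * nrm V x"
    using assms unfolding dual_def by blast
  have *: "\<bar>f x\<bar> \<le> \<bar>K\<bar>" if "x \<in> unit_ball V" for x
  proof -
    have "\<bar>f x\<bar> \<le> K * nrm V x"
      using that K by (simp add: unit_ball_def)
    also have "\<dots> \<le> \<bar>K\<bar> * nrm V x"
      using that by (intro mult_right_mono) (auto simp: unit_ball_def nrm_nonneg)
    also have "\<dots> \<le> \<bar>K\<bar>"
      using that by (intro mult_left_le) (auto simp: unit_ball_def)
    finally show ?thesis .
  qed
  show "bdd_above ((\<lambda>x. \<bar>f x\<bar>) ` unit_ball V)"
    using * by (intro bdd_aboveI2)
  show "bdd_above (f ` unit_ball V)"
    using * by (intro bdd_aboveI2[where M = "\<bar>K\<bar>"]) fastforce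
qed

lemma abs_le_dual_norm: "\<lbrakk>f \<in> dual V; x \<in> unit_ball V\<rbrakk> \<Longrightarrow> \<bar>f x\<bar> \<le> dual_norm V f"
  unfolding dual_norm_def by (rule cSUP_upper[OF _ bdd_above_abs_dual])

lemma dual_norm_nonneg: "f \<in> dual V \<Longrightarrow> 0 \<le> dual_norm V f"
  using abs_le_dual_norm[OF _ zero_mem_unit_ball] by fastforce

lemma dual_scale:
  assumes f: "f \<in> dual V"
  shows "(\<lambda>x. c * f x) \<in> dual V"
proof -
  obtain K where K: "\<forall>x\<in>carrier V. \<bar>f x\<bar> \<le> K * nrm V x"
    using f by (auto simp: dual_def)
  have "\<forall>x\<in>carrier V. \<bar>c * f x\<bar> \<le> (\<bar>c\<bar> * K) * nrm V x"
    using K by (simp add: abs_mult mult.assoc mult_left_mono)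
  then show ?thesis
    using f by (auto simp: dual_def distrib_left)
qed

text \<open>Slices are cut out by norm-one functionals; any functional that does not vanish on the ball
  can be normalised.\<close>

lemma slice_of_nonzero_functional:
  assumes g: "g \<in> dual V" and N: "dual_norm V g \<noteq> 0" and "0 < \<beta>"
  obtains T where "is_slice V T" "T \<subseteq> slice V g \<beta>"
proof
  define N where "N = dual_norm V g"
  define h where "h x = (1 / N) * g x" for x
  have pos: "N > 0"
    using N dual_norm_nonneg[OF g] by (simp add: N_def)
  have h: "h \<in> dual V"
    unfolding h_def by (rule dual_scale[OF g])
  have gh: "g x = N * h x" for x
    using pos by (simp add: h_def)
  have ne: "unit_ball V \<noteq> {}"
    using zero_mem_unit_ball by blast
  have "dual_norm V h \<le> 1"
    unfolding dual_norm_def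
  proof (rule cSUP_least[OF ne])
    fix x assume "x \<in> unit_ball V"
    with abs_le_dual_norm[OF g] pos show "\<bar>h x\<bar> \<le> 1"
      by (simp add: h_def N_def)
  qed
  moreover have "N \<le> N * dual_norm V h"
  proof -
    have "(SUP x\<in>unit_ball V. \<bar>g x\<bar>) \<le> N * dual_norm V h"
    proof (rule cSUP_least[OF ne])
      fix x assume "x \<in> unit_ball V"
      with abs_le_dual_norm[OF h] pos show "\<bar>g x\<bar> \<le> N * dual_norm V h"
        by (simp add: gh abs_mult)
    qed
    then show ?thesis
      by (simp add: N_def dual_norm_def)
  qed
  ultimately have "dual_norm V h = 1"
    using pos by simp
  then show "is_slice V (slice V h (\<beta> / N))"
    unfolding is_slice_def using h pos \<open>0 < \<beta>\<close> by (intro exI[of _ h] exI[of _ "\<beta> / N"]) simp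
  have "(SUP x\<in>unit_ball V. g x) \<le> N * (SUP x\<in>unit_ball V. h x)"
  proof (rule cSUP_least[OF ne])
    fix x assume "x \<in> unit_ball V"
    then show "g x \<le> N * (SUP x\<in>unit_ball V. h x)"
      using cSUP_upper[OF _ bdd_above_dual[OF h], of x] pos by (simp add: gh)
  qed
  then show "slice V h (\<beta> / N) \<subseteq> slice V g \<beta>"
    using pos by (auto simp: slice_def gh field_simps)
qed

lemma topspace_weak_topology: "topspace (weak_topology V) = carrier V"
proof -
  have "(\<lambda>_. 0) \<in> dual V"
    by (auto simp: dual_def intro: exI[of _ 0])
  then have "carrier V \<in> {{x \<in> carrier V. f x \<in> U} |f U. f \<in> dual V \<and> open U}"
    by (intro CollectI exI[of _ "\<lambda>_. 0"] exI[of _ UNIV]) auto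
  then show ?thesis
    unfolding weak_topology_def topology_generated_by_topspace by blast
qed

end

lemma is_slice_subset_unit_ball: "is_slice V S \<Longrightarrow> S \<subseteq> unit_ball V"
  by (auto simp: is_slice_def slice_def)

section \<open>Unit balls covered by translates of an embedded unit ball\<close>

text \<open>
  The last assumption holds in particular when \<open>W\<close> is the sum of \<open>J V\<close> and a complement, normed by
  the maximum of the two norms (\<open>J V\<close> is an M-summand): then \<open>z\<close> is the component of \<open>w\<close> in the
  complement.
\<close>

locale ball_translate_embedding =
  V: real_normed_space V + W: real_normed_space W
  for V :: "('a, 'm) normed_module_scheme" and W :: "('b, 'n) normed_module_scheme" +
  fixes J :: "'a \<Rightarrow> 'b"
  assumes J_mem: "x \<in> carrier V \<Longrightarrow> J x \<in> carrier W"
    and J_add: "\<lbrakk>x \<in> carrier V; y \<in> carrier V\<rbrakk> \<Longrightarrow> J (x \<oplus>\<^bsub>V\<^esub> y) = J x \<oplus>\<^bsub>W\<^esub> J y"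
    and J_smult: "x \<in> carrier V \<Longrightarrow> J (a \<odot>\<^bsub>V\<^esub> x) = a \<odot>\<^bsub>W\<^esub> J x"
    and nrm_J: "x \<in> carrier V \<Longrightarrow> nrm W (J x) = nrm V x"
    and translate: "w \<in> unit_ball W \<Longrightarrow> \<exists>v\<in>unit_ball V. \<exists>z\<in>carrier W.
      w = J v \<oplus>\<^bsub>W\<^esub> z \<and> (\<forall>x\<in>unit_ball V. J x \<oplus>\<^bsub>W\<^esub> z \<in> unit_ball W)"
begin

lemma ndist_translate:
  assumes "x \<in> carrier V" "y \<in> carrier V" "z \<in> carrier W"
  shows "ndist W (J x \<oplus>\<^bsub>W\<^esub> z) (J y \<oplus>\<^bsub>W\<^esub> z) = ndist V x y"
proof -
  have "\<ominus>\<^bsub>W\<^esub> (J y \<oplus>\<^bsub>W\<^esub> z) = \<ominus>\<^bsub>W\<^esub> J y \<oplus>\<^bsub>W\<^esub> \<ominus>\<^bsub>W\<^esub> z"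
    using assms J_mem by (simp add: W.M.minus_add)
  then have "(J x \<oplus>\<^bsub>W\<^esub> z) \<ominus>\<^bsub>W\<^esub> (J y \<oplus>\<^bsub>W\<^esub> z) = (J x \<oplus>\<^bsub>W\<^esub> \<ominus>\<^bsub>W\<^esub> J y) \<oplus>\<^bsub>W\<^esub> (z \<oplus>\<^bsub>W\<^esub> \<ominus>\<^bsub>W\<^esub> z)"
    using assms J_mem by (simp add: a_minus_def W.M.a_ac)
  also have "\<dots> = J x \<oplus>\<^bsub>W\<^esub> J (\<ominus>\<^bsub>V\<^esub> y)"
    using assms J_mem J_smult[of y "-1"]
    by (simp add: W.M.r_neg V.smult_minus_1 W.smult_minus_1)
  also have "\<dots> = J (x \<ominus>\<^bsub>V\<^esub> y)"
    using assms by (simp add: a_minus_def J_add)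
  finally show ?thesis
    using assms by (simp add: ndist_def nrm_J V.M.minus_closed)
qed

lemma diam_le_of_translate:
  assumes "T \<subseteq> carrier V" "z \<in> carrier W" "S \<subseteq> unit_ball W"
    and "\<And>x. x \<in> T \<Longrightarrow> J x \<oplus>\<^bsub>W\<^esub> z \<in> S"
  shows "diam V T \<le> diam W S"
proof (cases "T = {}")
  case False
  have "ndist V x y \<le> diam W S" if "x \<in> T" "y \<in> T" for x y
  proof -
    have "ndist V x y = ndist W (J x \<oplus>\<^bsub>W\<^esub> z) (J y \<oplus>\<^bsub>W\<^esub> z)"
      using ndist_translate[of x y z] that assms(1,2) by (simp add: subset_iff)
    also have "\<dots> \<le> diam W S"
      using that assms by (intro W.ndist_le_diam) auto
    finally show ?thesis .
  qed
  with False show ?thesis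
    by (auto simp: diam_def[of V] intro!: cSUP_least)
qed (use W.diam_nonneg assms in \<open>simp add: diam_def\<close>)

lemma dual_comp_J:
  assumes "f \<in> dual W"
  shows "f \<circ> J \<in> dual V"
proof -
  obtain K where K: "\<forall>x\<in>carrier W. \<bar>f x\<bar> \<le> K * nrm W x"
    using assms by (auto simp: dual_def)
  then have "\<forall>x\<in>carrier V. \<bar>f (J x)\<bar> \<le> K * nrm V x"
    using J_mem nrm_J by metis
  then show ?thesis
    using assms by (auto simp: dual_def J_add J_smult J_mem)
qed

lemma functional_translate:
  "\<lbrakk>f \<in> dual W; x \<in> carrier V; z \<in> carrier W\<rbrakk> \<Longrightarrow> f (J x \<oplus>\<^bsub>W\<^esub> z) = f (J x) + f z"
  by (simp add: dual_def J_mem)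

text \<open>
  A slice contains a point \<open>J v + z\<close> with \<open>v\<close> in the unit ball. On the translate through this
  point, the inequality that defines the slice by \<open>f\<close> is a lower bound on \<open>f \<circ> J\<close> that is strictly
  smaller than \<open>f (J v)\<close>, hence than the supremum of \<open>f \<circ> J\<close>.
\<close>

lemma slice_fibre:
  assumes "is_slice W S"
  obtains z T where "z \<in> carrier W" "is_slice V T \<or> T = unit_ball V"
    "\<And>x. x \<in> T \<Longrightarrow> J x \<oplus>\<^bsub>W\<^esub> z \<in> S"
proof -
  obtain f \<alpha> where f: "f \<in> dual W" and "\<alpha> > 0" and S: "S = slice W f \<alpha>"
    using assms by (auto simp: is_slice_def)
  define M where "M = (SUP y\<in>unit_ball W. f y)"
  have "M - \<alpha> < M"
    using \<open>\<alpha> > 0\<close> by simp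
  then obtain w where w: "w \<in> unit_ball W" "M - \<alpha> < f w"
    unfolding M_def
    using less_cSUP_iff[OF _ W.bdd_above_dual[OF f]] W.zero_mem_unit_ball by blast
  then obtain v z where v: "v \<in> unit_ball V" and z: "z \<in> carrier W" "w = J v \<oplus>\<^bsub>W\<^esub> z"
    and ball: "\<And>x. x \<in> unit_ball V \<Longrightarrow> J x \<oplus>\<^bsub>W\<^esub> z \<in> unit_ball W"
    using translate by blast
  define g where "g = f \<circ> J"
  define \<beta> where "\<beta> = (SUP x\<in>unit_ball V. g x) - (M - \<alpha> - f z)"
  have g: "g \<in> dual V"
    unfolding g_def by (rule dual_comp_J[OF f])
  have f_translate: "f (J x \<oplus>\<^bsub>W\<^esub> z) = g x + f z" if "x \<in> unit_ball V" for x
    using functional_translate[OF f] that z by (simp add: g_def unit_ball_def)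
  have "g v \<le> (SUP x\<in>unit_ball V. g x)"
    by (rule cSUP_upper[OF v V.bdd_above_dual[OF g]])
  moreover have "M - \<alpha> < g v + f z"
    using w(2) f_translate[OF v] z(2) by simp
  ultimately have "\<beta> > 0"
    by (simp add: \<beta>_def)
  have fibre: "J x \<oplus>\<^bsub>W\<^esub> z \<in> S" if "x \<in> slice V g \<beta>" for x
    using that ball f_translate[of x] by (auto simp: S slice_def \<beta>_def M_def)
  show thesis
  proof (cases "dual_norm V g = 0")
    case True
    have "g x = 0" if "x \<in> unit_ball V" for x
      using V.abs_le_dual_norm[OF g that] True by simp
    moreover from this have "(SUP x\<in>unit_ball V. g x) = (SUP x\<in>unit_ball V. 0)"
      by (intro SUP_cong) auto
    then have "(SUP x\<in>unit_ball V. g x) = 0"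
      using cSUP_const[of "unit_ball V" "0 :: real"] V.zero_mem_unit_ball by (metis empty_iff)
    ultimately have "slice V g \<beta> = unit_ball V"
      using \<open>\<beta> > 0\<close> by (auto simp: slice_def)
    then show thesis
      using that[of z "unit_ball V"] z fibre by blast
  next
    case False
    obtain T where "is_slice V T" "T \<subseteq> slice V g \<beta>"
      using V.slice_of_nonzero_functional[OF g False \<open>\<beta> > 0\<close>] by blast
    then show thesis
      using that[of z T] z fibre by blast
  qed
qed

lemma continuous_map_translate:
  assumes z: "z \<in> carrier W"
  shows "continuous_map (weak_topology V) (weak_topology W) (\<lambda>x. J x \<oplus>\<^bsub>W\<^esub> z)"
  unfolding weak_topology_def[of W]
proof (rule continuous_on_generated_topo)
  fix A assume "A \<in> {{x \<in> carrier W. f x \<in> U} |f U. f \<in> dual W \<and> open U}"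
  then obtain f U where A: "A = {x \<in> carrier W. f x \<in> U}" and f: "f \<in> dual W" and "open U"
    by blast
  have "open ((\<lambda>r. r + f z) -` U)"
    by (intro open_vimage \<open>open U\<close> continuous_intros)
  moreover have "(\<lambda>x. J x \<oplus>\<^bsub>W\<^esub> z) -` A \<inter> topspace (weak_topology V) =
      {x \<in> carrier V. (f \<circ> J) x \<in> (\<lambda>r. r + f z) -` U}"
    using z f by (auto simp: A V.topspace_weak_topology functional_translate J_mem)
  ultimately show "openin (weak_topology V) ((\<lambda>x. J x \<oplus>\<^bsub>W\<^esub> z) -` A \<inter> topspace (weak_topology V))"
    unfolding weak_topology_def[of V]
    using dual_comp_J[OF f] by (intro topology_generated_by_Basis) blast
next
  have "\<Union> {{x \<in> carrier W. f x \<in> U} |f U. f \<in> dual W \<and> open U} = carrier W"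
    using W.topspace_weak_topology
    unfolding weak_topology_def topology_generated_by_topspace .
  then show "(\<lambda>x. J x \<oplus>\<^bsub>W\<^esub> z) ` topspace (weak_topology V) \<subseteq>
      \<Union> {{x \<in> carrier W. f x \<in> U} |f U. f \<in> dual W \<and> open U}"
    using z by (auto simp: V.topspace_weak_topology J_mem)
qed

lemma BDP_pullback:
  assumes "BDP W" "carrier V \<noteq> {\<zero>\<^bsub>V\<^esub>}"
  shows "BDP V"
  unfolding BDP_def
proof (intro allI impI)
  fix \<epsilon> :: real assume "\<epsilon> > 0"
  then obtain S where S: "is_slice W S" "diam W S < min \<epsilon> 2"
    using assms(1) unfolding BDP_def by (metis min_less_iff_conj zero_less_numeral)
  obtain z T where z: "z \<in> carrier W" and T: "is_slice V T \<or> T = unit_ball V"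
    and sub: "\<And>x. x \<in> T \<Longrightarrow> J x \<oplus>\<^bsub>W\<^esub> z \<in> S"
    using slice_fibre[OF S(1)] by blast
  have "T \<subseteq> carrier V"
    using T is_slice_subset_unit_ball[of V T] by (auto simp: unit_ball_def)
  then have le: "diam V T \<le> diam W S"
    using z sub is_slice_subset_unit_ball[OF S(1)] by (intro diam_le_of_translate) auto
  then have "T \<noteq> unit_ball V"
    using S(2) V.diam_unit_ball[OF assms(2)] by auto
  with T le S(2) show "\<exists>S. is_slice V S \<and> diam V S < \<epsilon>"
    by auto
qed

lemma BHP_pullback:
  assumes "BHP W"
  shows "BHP V"
  unfolding BHP_def
proof (intro allI impI)
  fix \<epsilon> :: real assume "\<epsilon> > 0"
  then obtain S where S: "openin (subtopology (weak_topology W) (unit_ball W)) S" "S \<noteq> {}"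
    "diam W S < \<epsilon>"
    using assms unfolding BHP_def by blast
  obtain O' where O': "openin (weak_topology W) O'" "S = O' \<inter> unit_ball W"
    using S(1) by (auto simp: openin_subtopology)
  obtain v z where v: "v \<in> unit_ball V" and z: "z \<in> carrier W" "J v \<oplus>\<^bsub>W\<^esub> z \<in> S"
    and ball: "\<And>x. x \<in> unit_ball V \<Longrightarrow> J x \<oplus>\<^bsub>W\<^esub> z \<in> unit_ball W"
    using S(2) O'(2) translate by blast
  define T where
    "T = {x \<in> topspace (weak_topology V). J x \<oplus>\<^bsub>W\<^esub> z \<in> O'} \<inter> unit_ball V"
  have "openin (subtopology (weak_topology V) (unit_ball V)) T"
    unfolding T_def openin_subtopology
    using openin_continuous_map_preimage[OF continuous_map_translate[OF z(1)] O'(1)] by blast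
  moreover have "v \<in> T"
    using v z(2) O'(2) by (auto simp: T_def V.topspace_weak_topology unit_ball_def)
  moreover have "diam V T \<le> diam W S"
    using z(1) ball O'(2)
    by (intro diam_le_of_translate) (auto simp: T_def unit_ball_def[of V])
  ultimately show "\<exists>T. openin (subtopology (weak_topology V) (unit_ball V)) T \<and>
      T \<noteq> {} \<and> diam V T < \<epsilon>"
    using S(3) by (intro exI[of _ T]) auto
qed

lemma finsum_translate:
  assumes "finite A" "\<And>k. k \<in> A \<Longrightarrow> s k \<in> carrier V" "\<And>k. k \<in> A \<Longrightarrow> z k \<in> carrier W"
  shows "J (\<Oplus>\<^bsub>V\<^esub>k\<in>A. l k \<odot>\<^bsub>V\<^esub> s k) \<oplus>\<^bsub>W\<^esub> (\<Oplus>\<^bsub>W\<^esub>k\<in>A. l k \<odot>\<^bsub>W\<^esub> z k) =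
    (\<Oplus>\<^bsub>W\<^esub>k\<in>A. l k \<odot>\<^bsub>W\<^esub> (J (s k) \<oplus>\<^bsub>W\<^esub> z k))"
  using assms
proof (induction A rule: finite_induct)
  case empty
  have "J \<zero>\<^bsub>V\<^esub> = \<zero>\<^bsub>W\<^esub>"
    using J_smult[of "\<zero>\<^bsub>V\<^esub>" 0] by (simp add: J_mem)
  then show ?case by simp
next
  case (insert k A)
  let ?s = "\<Oplus>\<^bsub>V\<^esub>k\<in>A. l k \<odot>\<^bsub>V\<^esub> s k" and ?z = "\<Oplus>\<^bsub>W\<^esub>k\<in>A. l k \<odot>\<^bsub>W\<^esub> z k"
  have mem: "?s \<in> carrier V" "?z \<in> carrier W" "J ?s \<in> carrier W"
    "s k \<in> carrier V" "z k \<in> carrier W" "J (s k) \<in> carrier W"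
    using insert.prems by (auto intro!: V.finsum_smult_mem W.finsum_smult_mem J_mem)
  have "(\<Oplus>\<^bsub>V\<^esub>k\<in>insert k A. l k \<odot>\<^bsub>V\<^esub> s k) = l k \<odot>\<^bsub>V\<^esub> s k \<oplus>\<^bsub>V\<^esub> ?s"
    using insert.hyps insert.prems by (subst V.M.finsum_insert) auto
  moreover have "(\<Oplus>\<^bsub>W\<^esub>k\<in>insert k A. l k \<odot>\<^bsub>W\<^esub> z k) = l k \<odot>\<^bsub>W\<^esub> z k \<oplus>\<^bsub>W\<^esub> ?z"
    using insert.hyps insert.prems by (subst W.M.finsum_insert) auto
  moreover have "(\<Oplus>\<^bsub>W\<^esub>k\<in>insert k A. l k \<odot>\<^bsub>W\<^esub> (J (s k) \<oplus>\<^bsub>W\<^esub> z k)) =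
      l k \<odot>\<^bsub>W\<^esub> (J (s k) \<oplus>\<^bsub>W\<^esub> z k) \<oplus>\<^bsub>W\<^esub> (\<Oplus>\<^bsub>W\<^esub>k\<in>A. l k \<odot>\<^bsub>W\<^esub> (J (s k) \<oplus>\<^bsub>W\<^esub> z k))"
    using insert.hyps insert.prems by (subst W.M.finsum_insert) (auto simp: J_mem)
  moreover have "(\<Oplus>\<^bsub>W\<^esub>k\<in>A. l k \<odot>\<^bsub>W\<^esub> (J (s k) \<oplus>\<^bsub>W\<^esub> z k)) = J ?s \<oplus>\<^bsub>W\<^esub> ?z"
    using insert by simp
  ultimately show ?case
    using mem by (simp add: J_add J_smult W.smult_distrib_right W.M.a_ac)
qed

lemma BSCSP_pullback:
  assumes "BSCSP W" "carrier V \<noteq> {\<zero>\<^bsub>V\<^esub>}"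
  shows "BSCSP V"
  unfolding BSCSP_def
proof (intro allI impI)
  fix \<epsilon> :: real assume "\<epsilon> > 0"
  then obtain C where "is_convex_comb_of_slices W C" and diam_C: "diam W C < min \<epsilon> 2"
    using assms(1) unfolding BSCSP_def by (metis min_less_iff_conj zero_less_numeral)
  then obtain n :: nat and l :: "nat \<Rightarrow> real" and S :: "nat \<Rightarrow> 'b set"
    where S: "\<And>k. k \<in> {1..n} \<Longrightarrow> is_slice W (S k)"
      and l: "\<And>k. k \<in> {1..n} \<Longrightarrow> 0 \<le> l k \<and> l k \<le> 1" and sum_l: "(\<Sum>k=1..n. l k) = 1"
      and C: "C = {(\<Oplus>\<^bsub>W\<^esub>k\<in>{1..n}. l k \<odot>\<^bsub>W\<^esub> s k) | s. \<forall>k\<in>{1..n}. s k \<in> S k}"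
    unfolding is_convex_comb_of_slices_def by blast
  have C_ball: "C \<subseteq> unit_ball W"
  proof
    fix c assume "c \<in> C"
    then obtain s where c: "c = (\<Oplus>\<^bsub>W\<^esub>k\<in>{1..n}. l k \<odot>\<^bsub>W\<^esub> s k)" and "\<forall>k\<in>{1..n}. s k \<in> S k"
      unfolding C by blast
    then have s: "s k \<in> unit_ball W" if "k \<in> {1..n}" for k
      using that is_slice_subset_unit_ball[OF S] by blast
    have "c \<in> carrier W"
      unfolding c using s by (intro W.finsum_smult_mem) (simp add: unit_ball_def)
    moreover have "nrm W c \<le> 1"
      unfolding c sum_l[symmetric] using s l by (intro W.nrm_finsum_smult_le) auto
    ultimately show "c \<in> unit_ball W"
      by (simp add: unit_ball_def)
  qed
  have "\<exists>z T. z \<in> carrier W \<and> (is_slice V T \<or> T = unit_ball V) \<and> (\<forall>x\<in>T. J x \<oplus>\<^bsub>W\<^esub> z \<in> S k)"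
    if "k \<in> {1..n}" for k
    using slice_fibre[OF S[OF that]] by metis
  then obtain z T where z: "\<And>k. k \<in> {1..n} \<Longrightarrow> z k \<in> carrier W"
    and T: "\<And>k. k \<in> {1..n} \<Longrightarrow> is_slice V (T k) \<or> T k = unit_ball V"
    and sub: "\<And>k x. k \<in> {1..n} \<Longrightarrow> x \<in> T k \<Longrightarrow> J x \<oplus>\<^bsub>W\<^esub> z k \<in> S k"
    by metis
  have T_ball: "T k \<subseteq> unit_ball V" if "k \<in> {1..n}" for k
    using T[OF that] is_slice_subset_unit_ball by blast
  define z0 where "z0 = (\<Oplus>\<^bsub>W\<^esub>k\<in>{1..n}. l k \<odot>\<^bsub>W\<^esub> z k)"
  have z0: "z0 \<in> carrier W"
    unfolding z0_def using z by (rule W.finsum_smult_mem)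
  have comb: "J (\<Oplus>\<^bsub>V\<^esub>k\<in>{1..n}. l k \<odot>\<^bsub>V\<^esub> s k) \<oplus>\<^bsub>W\<^esub> z0 \<in> C"
    if s: "\<And>k. k \<in> {1..n} \<Longrightarrow> s k \<in> T k" for s
  proof -
    have "s k \<in> carrier V" if "k \<in> {1..n}" for k
      using s[OF that] T_ball[OF that] by (auto simp: unit_ball_def)
    then have "J (\<Oplus>\<^bsub>V\<^esub>k\<in>{1..n}. l k \<odot>\<^bsub>V\<^esub> s k) \<oplus>\<^bsub>W\<^esub> z0 =
        (\<Oplus>\<^bsub>W\<^esub>k\<in>{1..n}. l k \<odot>\<^bsub>W\<^esub> (J (s k) \<oplus>\<^bsub>W\<^esub> z k))"
      unfolding z0_def using z by (intro finsum_translate) auto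
    moreover have "\<forall>k\<in>{1..n}. J (s k) \<oplus>\<^bsub>W\<^esub> z k \<in> S k"
      using s sub by blast
    ultimately show ?thesis
      unfolding C by (intro CollectI exI[of _ "\<lambda>k. J (s k) \<oplus>\<^bsub>W\<^esub> z k"]) simp
  qed
  have "\<exists>j\<in>{1..n}. is_slice V (T j)"
  proof (rule ccontr)
    assume "\<not> ?thesis"
    then have all_ball: "T k = unit_ball V" if "k \<in> {1..n}" for k
      using T that by blast
    \<comment> \<open>As the weights sum to \<open>1\<close>, the constant choice \<open>s k = x\<close> gives \<open>J x + z0 \<in> C\<close>.\<close>
    have "J x \<oplus>\<^bsub>W\<^esub> z0 \<in> C" if "x \<in> unit_ball V" for x
    proof -
      have x: "x \<in> carrier V"
        using that by (simp add: unit_ball_def)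
      have "J (\<Oplus>\<^bsub>V\<^esub>k\<in>{1..n}. l k \<odot>\<^bsub>V\<^esub> x) \<oplus>\<^bsub>W\<^esub> z0 \<in> C"
        using that all_ball by (intro comb) auto
      then show ?thesis
        using x by (simp only: V.finsum_smult_left finite_atLeastAtMost sum_l V.smult_1)
    qed
    then have "diam V (unit_ball V) \<le> diam W C"
      using z0 C_ball by (intro diam_le_of_translate) (auto simp: unit_ball_def)
    then show False
      using diam_C V.diam_unit_ball[OF assms(2)] by simp
  qed
  then obtain j where j: "j \<in> {1..n}" "is_slice V (T j)" by blast
  define T' where "T' k = (if is_slice V (T k) then T k else T j)" for k
  have T': "is_slice V (T' k)" "T' k \<subseteq> T k" if "k \<in> {1..n}" for k
    using T[OF that] j T_ball[OF j(1)] by (auto simp: T'_def)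
  define D where "D = {(\<Oplus>\<^bsub>V\<^esub>k\<in>{1..n}. l k \<odot>\<^bsub>V\<^esub> s k) | s. \<forall>k\<in>{1..n}. s k \<in> T' k}"
  have "is_convex_comb_of_slices V D"
    unfolding is_convex_comb_of_slices_def D_def using T'(1) l sum_l by blast
  moreover have "diam V D \<le> diam W C"
  proof (rule diam_le_of_translate[OF _ z0 C_ball])
    show "D \<subseteq> carrier V"
      unfolding D_def using T'(2) T_ball
      by (force simp: unit_ball_def intro!: V.finsum_smult_mem)
    show "J x \<oplus>\<^bsub>W\<^esub> z0 \<in> C" if "x \<in> D" for x
    proof -
      obtain s where "x = (\<Oplus>\<^bsub>V\<^esub>k\<in>{1..n}. l k \<odot>\<^bsub>V\<^esub> s k)" "\<forall>k\<in>{1..n}. s k \<in> T' k"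
        using \<open>x \<in> D\<close> unfolding D_def by blast
      with T'(2) comb[of s] show ?thesis
        by blast
    qed
  qed
  ultimately show "\<exists>C. is_convex_comb_of_slices V C \<and> diam V C < \<epsilon>"
    using diam_C by auto
qed

end

section \<open>The \<open>c\<^sub>0\<close>-sum and its coordinate embeddings\<close>

locale normed_family =
  fixes \<Gamma> :: "'i set" and X :: "'i \<Rightarrow> ('a, 'm) normed_module_scheme"
  assumes normed: "i \<in> \<Gamma> \<Longrightarrow> real_normed_space (X i)"
begin

abbreviation "W \<equiv> c0_sum \<Gamma> X"

lemma mem_comp: "\<lbrakk>x \<in> carrier W; i \<in> \<Gamma>\<rbrakk> \<Longrightarrow> x i \<in> carrier (X i)"
  by (auto simp: c0_sum_def)

lemma add_comp: "i \<in> \<Gamma> \<Longrightarrow> (x \<oplus>\<^bsub>W\<^esub> y) i = x i \<oplus>\<^bsub>X i\<^esub> y i"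
  by (simp add: c0_sum_def)

lemma smult_comp: "i \<in> \<Gamma> \<Longrightarrow> (a \<odot>\<^bsub>W\<^esub> x) i = a \<odot>\<^bsub>X i\<^esub> x i"
  by (simp add: c0_sum_def)

lemma zero_comp: "i \<in> \<Gamma> \<Longrightarrow> \<zero>\<^bsub>W\<^esub> i = \<zero>\<^bsub>X i\<^esub>"
  by (simp add: c0_sum_def)

lemma finite_comp: "\<lbrakk>x \<in> carrier W; \<epsilon> > 0\<rbrakk> \<Longrightarrow> finite {i \<in> \<Gamma>. \<epsilon> \<le> nrm (X i) (x i)}"
  by (simp add: c0_sum_def)

lemma memI:
  assumes "\<And>i. i \<in> \<Gamma> \<Longrightarrow> x i \<in> carrier (X i)" "\<And>i. i \<notin> \<Gamma> \<Longrightarrow> x i = undefined"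
    and "\<And>\<epsilon>. \<epsilon> > 0 \<Longrightarrow> finite {i \<in> \<Gamma>. \<epsilon> \<le> nrm (X i) (x i)}"
  shows "x \<in> carrier W"
  using assms by (auto simp: c0_sum_def PiE_def extensional_def)

lemma ext:
  assumes "x \<in> carrier W" "y \<in> carrier W" "\<And>i. i \<in> \<Gamma> \<Longrightarrow> x i = y i"
  shows "x = y"
  using assms by (auto simp: c0_sum_def intro: PiE_ext)

lemma add_mem:
  assumes x: "x \<in> carrier W" and y: "y \<in> carrier W"
  shows "x \<oplus>\<^bsub>W\<^esub> y \<in> carrier W"
proof (rule memI)
  fix i assume i: "i \<in> \<Gamma>"
  interpret Xi: real_normed_space "X i" by (rule normed[OF i])
  show "(x \<oplus>\<^bsub>W\<^esub> y) i \<in> carrier (X i)"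
    using i x y mem_comp by (simp add: add_comp)
next
  fix \<epsilon> :: real assume "\<epsilon> > 0"
  have "{i \<in> \<Gamma>. \<epsilon> \<le> nrm (X i) ((x \<oplus>\<^bsub>W\<^esub> y) i)} \<subseteq>
      {i \<in> \<Gamma>. \<epsilon> / 2 \<le> nrm (X i) (x i)} \<union> {i \<in> \<Gamma>. \<epsilon> / 2 \<le> nrm (X i) (y i)}"
  proof
    fix i assume "i \<in> {i \<in> \<Gamma>. \<epsilon> \<le> nrm (X i) ((x \<oplus>\<^bsub>W\<^esub> y) i)}"
    then have i: "i \<in> \<Gamma>" and le: "\<epsilon> \<le> nrm (X i) (x i \<oplus>\<^bsub>X i\<^esub> y i)"
      by (auto simp: add_comp)
    have "nrm (X i) (x i \<oplus>\<^bsub>X i\<^esub> y i) \<le> nrm (X i) (x i) + nrm (X i) (y i)"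
      using real_normed_space.nrm_triangle[OF normed[OF i]] mem_comp x y i by blast
    with i le show "i \<in> {i \<in> \<Gamma>. \<epsilon> / 2 \<le> nrm (X i) (x i)} \<union> {i \<in> \<Gamma>. \<epsilon> / 2 \<le> nrm (X i) (y i)}"
      by auto
  qed
  then show "finite {i \<in> \<Gamma>. \<epsilon> \<le> nrm (X i) ((x \<oplus>\<^bsub>W\<^esub> y) i)}"
    using finite_comp[OF x, of "\<epsilon> / 2"] finite_comp[OF y, of "\<epsilon> / 2"] \<open>\<epsilon> > 0\<close>
    by (auto intro: finite_subset)
qed (simp add: c0_sum_def)

lemma smult_mem:
  assumes x: "x \<in> carrier W"
  shows "a \<odot>\<^bsub>W\<^esub> x \<in> carrier W"
proof (rule memI)
  fix i assume i: "i \<in> \<Gamma>"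
  interpret Xi: real_normed_space "X i" by (rule normed[OF i])
  show "(a \<odot>\<^bsub>W\<^esub> x) i \<in> carrier (X i)"
    using i x mem_comp by (simp add: smult_comp)
next
  fix \<epsilon> :: real assume "\<epsilon> > 0"
  have "{i \<in> \<Gamma>. \<epsilon> \<le> nrm (X i) ((a \<odot>\<^bsub>W\<^esub> x) i)} \<subseteq> {i \<in> \<Gamma>. \<epsilon> / (\<bar>a\<bar> + 1) \<le> nrm (X i) (x i)}"
  proof
    fix i assume "i \<in> {i \<in> \<Gamma>. \<epsilon> \<le> nrm (X i) ((a \<odot>\<^bsub>W\<^esub> x) i)}"
    then have i: "i \<in> \<Gamma>" and le: "\<epsilon> \<le> nrm (X i) (a \<odot>\<^bsub>X i\<^esub> x i)"
      by (auto simp: smult_comp)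
    interpret Xi: real_normed_space "X i" by (rule normed[OF i])
    have "\<epsilon> \<le> (\<bar>a\<bar> + 1) * nrm (X i) (x i)"
      using le Xi.nrm_smult[of "x i" a] Xi.nrm_nonneg[of "x i"] mem_comp[OF x i]
      by (simp add: distrib_right)
    then show "i \<in> {i \<in> \<Gamma>. \<epsilon> / (\<bar>a\<bar> + 1) \<le> nrm (X i) (x i)}"
      using i by (simp add: pos_divide_le_eq mult.commute)
  qed
  moreover have "\<epsilon> / (\<bar>a\<bar> + 1) > 0"
    using \<open>\<epsilon> > 0\<close> by simp
  ultimately show "finite {i \<in> \<Gamma>. \<epsilon> \<le> nrm (X i) ((a \<odot>\<^bsub>W\<^esub> x) i)}"
    using finite_comp[OF x] finite_subset by blast
qed (simp add: c0_sum_def)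

definition coord :: "'i \<Rightarrow> 'a \<Rightarrow> 'i \<Rightarrow> 'a" where
  "coord i v = (\<lambda>j\<in>\<Gamma>. if j = i then v else \<zero>\<^bsub>X j\<^esub>)"

lemma zero_mem_comp: "i \<in> \<Gamma> \<Longrightarrow> \<zero>\<^bsub>X i\<^esub> \<in> carrier (X i)"
  and nrm_zero_comp: "i \<in> \<Gamma> \<Longrightarrow> nrm (X i) \<zero>\<^bsub>X i\<^esub> = 0"
proof -
  assume i: "i \<in> \<Gamma>"
  interpret Xi: real_normed_space "X i" by (rule normed[OF i])
  show "\<zero>\<^bsub>X i\<^esub> \<in> carrier (X i)" "nrm (X i) \<zero>\<^bsub>X i\<^esub> = 0"
    by simp_all
qed

lemma zero_mem: "\<zero>\<^bsub>W\<^esub> \<in> carrier W"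
proof (rule memI)
  fix \<epsilon> :: real assume "\<epsilon> > 0"
  then have "{i \<in> \<Gamma>. \<epsilon> \<le> nrm (X i) (\<zero>\<^bsub>W\<^esub> i)} = {}"
    by (auto simp: zero_comp nrm_zero_comp)
  then show "finite {i \<in> \<Gamma>. \<epsilon> \<le> nrm (X i) (\<zero>\<^bsub>W\<^esub> i)}"
    by (simp only: finite.emptyI)
qed (auto simp: zero_comp zero_mem_comp, simp add: c0_sum_def)

lemma coord_mem:
  assumes "i \<in> \<Gamma>" "v \<in> carrier (X i)"
  shows "coord i v \<in> carrier W"
proof (rule memI)
  fix \<epsilon> :: real assume "\<epsilon> > 0"
  then have "{j \<in> \<Gamma>. \<epsilon> \<le> nrm (X j) (coord i v j)} \<subseteq> {i}"
    by (auto simp: coord_def nrm_zero_comp split: if_splits)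
  then show "finite {j \<in> \<Gamma>. \<epsilon> \<le> nrm (X j) (coord i v j)}"
    by (rule finite_subset) simp
qed (use assms in \<open>auto simp: coord_def zero_mem_comp\<close>)

lemma nrm_le_iff:
  assumes x: "x \<in> carrier W"
  shows "nrm W x \<le> K \<longleftrightarrow> 0 \<le> K \<and> (\<forall>i\<in>\<Gamma>. nrm (X i) (x i) \<le> K)"
proof -
  let ?n = "\<lambda>i. nrm (X i) (x i)"
  \<comment> \<open>The supremum is finite, because only finitely many components have norm at least \<open>1\<close>.\<close>
  have "bdd_above (?n ` {i \<in> \<Gamma>. 1 \<le> ?n i})"
    using finite_comp[OF x, of 1] by simp
  moreover have "bdd_above (?n ` {i \<in> \<Gamma>. \<not> 1 \<le> ?n i})"
    by (intro bdd_aboveI2[where M = 1]) auto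
  ultimately have "bdd_above (?n ` {i \<in> \<Gamma>. 1 \<le> ?n i} \<union> ?n ` {i \<in> \<Gamma>. \<not> 1 \<le> ?n i})"
    by simp
  moreover have "?n ` {i \<in> \<Gamma>. 1 \<le> ?n i} \<union> ?n ` {i \<in> \<Gamma>. \<not> 1 \<le> ?n i} = ?n ` \<Gamma>"
    by blast
  ultimately have "bdd_above (insert 0 (?n ` \<Gamma>))"
    by simp
  moreover have "nrm W x = Sup (insert 0 (?n ` \<Gamma>))"
    by (simp add: c0_sum_def)
  ultimately show ?thesis
    by (simp add: cSup_le_iff)
qed

lemma nrm_comp_le: "\<lbrakk>x \<in> carrier W; i \<in> \<Gamma>\<rbrakk> \<Longrightarrow> nrm (X i) (x i) \<le> nrm W x"
  using nrm_le_iff[of x "nrm W x"] by simp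

lemma nrm_nonneg: "x \<in> carrier W \<Longrightarrow> 0 \<le> nrm W x"
  using nrm_le_iff[of x "nrm W x"] by simp

lemma abelian_group_c0_sum: "abelian_group W"
proof (rule abelian_groupI)
  fix x y z assume mem: "x \<in> carrier W" "y \<in> carrier W" "z \<in> carrier W"
  show "(x \<oplus>\<^bsub>W\<^esub> y) \<oplus>\<^bsub>W\<^esub> z = x \<oplus>\<^bsub>W\<^esub> (y \<oplus>\<^bsub>W\<^esub> z)"
  proof (rule ext)
    fix i assume i: "i \<in> \<Gamma>"
    interpret Xi: real_normed_space "X i" by (rule normed[OF i])
    show "((x \<oplus>\<^bsub>W\<^esub> y) \<oplus>\<^bsub>W\<^esub> z) i = (x \<oplus>\<^bsub>W\<^esub> (y \<oplus>\<^bsub>W\<^esub> z)) i"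
      using mem_comp[OF _ i] mem i by (simp add: add_comp Xi.M.a_assoc)
  qed (use mem add_mem in auto)
next
  fix x y assume mem: "x \<in> carrier W" "y \<in> carrier W"
  show "x \<oplus>\<^bsub>W\<^esub> y = y \<oplus>\<^bsub>W\<^esub> x"
  proof (rule ext)
    fix i assume i: "i \<in> \<Gamma>"
    interpret Xi: real_normed_space "X i" by (rule normed[OF i])
    show "(x \<oplus>\<^bsub>W\<^esub> y) i = (y \<oplus>\<^bsub>W\<^esub> x) i"
      using mem_comp[OF _ i] mem i by (simp add: add_comp Xi.M.a_comm)
  qed (use mem add_mem in auto)
next
  fix x assume mem: "x \<in> carrier W"
  show "\<zero>\<^bsub>W\<^esub> \<oplus>\<^bsub>W\<^esub> x = x"
  proof (rule ext)
    fix i assume i: "i \<in> \<Gamma>"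
    interpret Xi: real_normed_space "X i" by (rule normed[OF i])
    show "(\<zero>\<^bsub>W\<^esub> \<oplus>\<^bsub>W\<^esub> x) i = x i"
      using mem_comp[OF mem i] i by (simp add: add_comp zero_comp)
  qed (use mem add_mem zero_mem in auto)
  show "\<exists>y\<in>carrier W. y \<oplus>\<^bsub>W\<^esub> x = \<zero>\<^bsub>W\<^esub>"
  proof (rule bexI[of _ "(-1) \<odot>\<^bsub>W\<^esub> x"], rule ext)
    fix i assume i: "i \<in> \<Gamma>"
    interpret Xi: real_normed_space "X i" by (rule normed[OF i])
    show "((-1) \<odot>\<^bsub>W\<^esub> x \<oplus>\<^bsub>W\<^esub> x) i = \<zero>\<^bsub>W\<^esub> i"
      using mem_comp[OF mem i] i
      by (simp add: add_comp smult_comp zero_comp Xi.smult_minus_1 Xi.M.l_neg)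
  qed (use mem add_mem smult_mem zero_mem in auto)
qed (use add_mem zero_mem in auto)

lemma cring_real_scalars: "cring real_scalars"
proof (rule cringI)
  show "abelian_group real_scalars"
    by (rule abelian_groupI) (auto intro: exI[of _ "- x" for x :: real] simp: add.assoc)
  show "Group.comm_monoid real_scalars"
    by (rule comm_monoidI) auto
qed (simp add: distrib_right)

lemma module_c0_sum: "module real_scalars W"
proof (rule moduleI[OF cring_real_scalars abelian_group_c0_sum])
  fix a b x assume mem: "x \<in> carrier W"
  show "a \<odot>\<^bsub>W\<^esub> x \<in> carrier W"
    by (rule smult_mem[OF mem])
  show "(a \<oplus>\<^bsub>real_scalars\<^esub> b) \<odot>\<^bsub>W\<^esub> x = a \<odot>\<^bsub>W\<^esub> x \<oplus>\<^bsub>W\<^esub> b \<odot>\<^bsub>W\<^esub> x"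
  proof (rule ext)
    fix i assume i: "i \<in> \<Gamma>"
    interpret Xi: real_normed_space "X i" by (rule normed[OF i])
    show "((a \<oplus>\<^bsub>real_scalars\<^esub> b) \<odot>\<^bsub>W\<^esub> x) i = (a \<odot>\<^bsub>W\<^esub> x \<oplus>\<^bsub>W\<^esub> b \<odot>\<^bsub>W\<^esub> x) i"
      using mem_comp[OF mem i] i by (simp add: add_comp smult_comp Xi.smult_distrib_left)
  qed (use mem add_mem smult_mem in auto)
  show "(a \<otimes>\<^bsub>real_scalars\<^esub> b) \<odot>\<^bsub>W\<^esub> x = a \<odot>\<^bsub>W\<^esub> (b \<odot>\<^bsub>W\<^esub> x)"
  proof (rule ext)
    fix i assume i: "i \<in> \<Gamma>"
    interpret Xi: real_normed_space "X i" by (rule normed[OF i])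
    show "((a \<otimes>\<^bsub>real_scalars\<^esub> b) \<odot>\<^bsub>W\<^esub> x) i = (a \<odot>\<^bsub>W\<^esub> (b \<odot>\<^bsub>W\<^esub> x)) i"
      using mem_comp[OF mem i] i by (simp add: smult_comp Xi.smult_assoc)
  qed (use mem smult_mem in auto)
  show "\<one>\<^bsub>real_scalars\<^esub> \<odot>\<^bsub>W\<^esub> x = x"
  proof (rule ext)
    fix i assume i: "i \<in> \<Gamma>"
    interpret Xi: real_normed_space "X i" by (rule normed[OF i])
    show "(\<one>\<^bsub>real_scalars\<^esub> \<odot>\<^bsub>W\<^esub> x) i = x i"
      using mem_comp[OF mem i] i by (simp add: smult_comp)
  qed (use mem smult_mem in auto)
next
  fix a x y assume mem: "x \<in> carrier W" "y \<in> carrier W"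
  show "a \<odot>\<^bsub>W\<^esub> (x \<oplus>\<^bsub>W\<^esub> y) = a \<odot>\<^bsub>W\<^esub> x \<oplus>\<^bsub>W\<^esub> a \<odot>\<^bsub>W\<^esub> y"
  proof (rule ext)
    fix i assume i: "i \<in> \<Gamma>"
    interpret Xi: real_normed_space "X i" by (rule normed[OF i])
    show "(a \<odot>\<^bsub>W\<^esub> (x \<oplus>\<^bsub>W\<^esub> y)) i = (a \<odot>\<^bsub>W\<^esub> x \<oplus>\<^bsub>W\<^esub> a \<odot>\<^bsub>W\<^esub> y) i"
      using mem_comp[OF _ i] mem i by (simp add: add_comp smult_comp Xi.smult_distrib_right)
  qed (use mem add_mem smult_mem in auto)
qed

lemma nrm_smult_le:
  assumes x: "x \<in> carrier W"
  shows "nrm W (a \<odot>\<^bsub>W\<^esub> x) \<le> \<bar>a\<bar> * nrm W x"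
proof -
  have "nrm (X i) ((a \<odot>\<^bsub>W\<^esub> x) i) \<le> \<bar>a\<bar> * nrm W x" if i: "i \<in> \<Gamma>" for i
    using real_normed_space.nrm_smult[OF normed[OF i] mem_comp[OF x i]] nrm_comp_le[OF x i] i
    by (simp add: smult_comp mult_left_mono)
  then show ?thesis
    using x by (simp add: nrm_le_iff smult_mem nrm_nonneg)
qed

lemma real_normed_space_c0_sum: "real_normed_space W"
proof -
  interpret module real_scalars W by (rule module_c0_sum)
  show ?thesis
  proof
    fix x assume x: "x \<in> carrier W"
    show "nrm W x = 0 \<longleftrightarrow> x = \<zero>\<^bsub>W\<^esub>"
    proof
      assume 0: "nrm W x = 0"
      show "x = \<zero>\<^bsub>W\<^esub>"
      proof (rule ext[OF x zero_mem])
        fix i assume i: "i \<in> \<Gamma>"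
        interpret Xi: real_normed_space "X i" by (rule normed[OF i])
        have "nrm (X i) (x i) = 0"
          using nrm_comp_le[OF x i] 0 Xi.nrm_nonneg[OF mem_comp[OF x i]] by simp
        then show "x i = \<zero>\<^bsub>W\<^esub> i"
          using Xi.nrm_eq_zero[OF mem_comp[OF x i]] i by (simp add: zero_comp)
      qed
    next
      assume "x = \<zero>\<^bsub>W\<^esub>"
      then have "nrm W x \<le> 0"
        by (simp add: nrm_le_iff zero_mem zero_comp nrm_zero_comp)
      then show "nrm W x = 0"
        using nrm_nonneg[OF x] by simp
    qed
    show "nrm W (a \<odot>\<^bsub>W\<^esub> x) = \<bar>a\<bar> * nrm W x" for a
    proof (rule antisym[OF nrm_smult_le[OF x]])
      show "\<bar>a\<bar> * nrm W x \<le> nrm W (a \<odot>\<^bsub>W\<^esub> x)"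
      proof (cases "a = 0")
        case False
        have "x = (1 / a) \<odot>\<^bsub>W\<^esub> (a \<odot>\<^bsub>W\<^esub> x)"
          using smult_assoc1[of "1 / a" a x] smult_one[of x] x False by simp
        then have "nrm W x \<le> \<bar>1 / a\<bar> * nrm W (a \<odot>\<^bsub>W\<^esub> x)"
          using nrm_smult_le[of "a \<odot>\<^bsub>W\<^esub> x" "1 / a"] smult_mem[OF x] by simp
        then show ?thesis
          using False by (simp add: field_simps)
      qed (use x smult_mem nrm_nonneg in simp)
    qed
  next
    fix x y assume mem: "x \<in> carrier W" "y \<in> carrier W"
    have "nrm (X i) ((x \<oplus>\<^bsub>W\<^esub> y) i) \<le> nrm W x + nrm W y" if i: "i \<in> \<Gamma>" for i
      using real_normed_space.nrm_triangle[OF normed[OF i], of "x i" "y i"] mem_comp[OF _ i]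
        nrm_comp_le[OF mem(1) i] nrm_comp_le[OF mem(2) i] mem i
      by (simp add: add_comp)
    then show "nrm W (x \<oplus>\<^bsub>W\<^esub> y) \<le> nrm W x + nrm W y"
      using mem by (simp add: nrm_le_iff add_mem nrm_nonneg)
  qed
qed

text \<open>
  The translation vector of a point \<open>w\<close> is \<open>w\<close> with its \<open>i\<close>-th coordinate replaced by zero; the
  translate then consists of all points that agree with \<open>w\<close> off \<open>i\<close> and have their \<open>i\<close>-th coordinate
  in the unit ball of the summand.
\<close>

lemma ball_translate_embedding_coord:
  assumes i: "i \<in> \<Gamma>"
  shows "ball_translate_embedding (X i) W (coord i)"
proof -
  interpret Xi: real_normed_space "X i" by (rule normed[OF i])
  interpret W: real_normed_space W by (rule real_normed_space_c0_sum)
  show ?thesis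
  proof
    fix v assume v: "v \<in> carrier (X i)"
    show mem: "coord i v \<in> carrier W"
      by (rule coord_mem[OF i v])
    show "coord i (v \<oplus>\<^bsub>X i\<^esub> u) = coord i v \<oplus>\<^bsub>W\<^esub> coord i u" if u: "u \<in> carrier (X i)" for u
    proof (rule ext)
      fix j assume j: "j \<in> \<Gamma>"
      interpret Xj: real_normed_space "X j" by (rule normed[OF j])
      show "coord i (v \<oplus>\<^bsub>X i\<^esub> u) j = (coord i v \<oplus>\<^bsub>W\<^esub> coord i u) j"
        using j by (simp add: add_comp) (simp add: coord_def)
    qed (use u v i coord_mem add_mem in auto)
    show "coord i (a \<odot>\<^bsub>X i\<^esub> v) = a \<odot>\<^bsub>W\<^esub> coord i v" for a
    proof (rule ext)
      fix j assume j: "j \<in> \<Gamma>"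
      interpret Xj: real_normed_space "X j" by (rule normed[OF j])
      have "a \<odot>\<^bsub>X j\<^esub> \<zero>\<^bsub>X j\<^esub> = \<zero>\<^bsub>X j\<^esub>"
        using Xj.smult_r_null[of a] by simp
      with j show "coord i (a \<odot>\<^bsub>X i\<^esub> v) j = (a \<odot>\<^bsub>W\<^esub> coord i v) j"
        by (simp add: smult_comp) (simp add: coord_def)
    qed (use v i coord_mem smult_mem in auto)
    show "nrm W (coord i v) = nrm (X i) v"
    proof (rule antisym)
      show "nrm W (coord i v) \<le> nrm (X i) v"
        using mem v Xi.nrm_nonneg by (simp add: nrm_le_iff) (simp add: coord_def nrm_zero_comp)
      show "nrm (X i) v \<le> nrm W (coord i v)"
        using nrm_comp_le[OF mem i] i by (simp add: coord_def)
    qed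
  next
    fix w assume "w \<in> unit_ball W"
    then have w: "w \<in> carrier W" and w_le: "\<And>j. j \<in> \<Gamma> \<Longrightarrow> nrm (X j) (w j) \<le> 1"
      by (auto simp: unit_ball_def nrm_le_iff)
    define z where "z = w \<ominus>\<^bsub>W\<^esub> coord i (w i)"
    have wi: "w i \<in> carrier (X i)"
      by (rule mem_comp[OF w i])
    have z: "z \<in> carrier W"
      unfolding z_def using w coord_mem[OF i wi] by (rule W.M.minus_closed)
    have w_eq: "w = coord i (w i) \<oplus>\<^bsub>W\<^esub> z"
      using w coord_mem[OF i wi] by (simp add: z_def a_minus_def W.M.a_lcomm W.M.r_neg)
    have z_comp: "z j = (if j = i then \<zero>\<^bsub>X i\<^esub> else w j)" if j: "j \<in> \<Gamma>" for j
    proof -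
      interpret Xj: real_normed_space "X j" by (rule normed[OF j])
      have "w j = coord i (w i) j \<oplus>\<^bsub>X j\<^esub> z j"
        using w_eq j by (metis add_comp)
      then show ?thesis
        using mem_comp[OF z j] mem_comp[OF w j] j
        by (auto simp: coord_def split: if_splits)
    qed
    have "coord i x \<oplus>\<^bsub>W\<^esub> z \<in> unit_ball W" if x: "x \<in> unit_ball (X i)" for x
    proof -
      have xc: "x \<in> carrier (X i)" "nrm (X i) x \<le> 1"
        using x by (auto simp: unit_ball_def)
      have "nrm (X j) ((coord i x \<oplus>\<^bsub>W\<^esub> z) j) \<le> 1" if j: "j \<in> \<Gamma>" for j
      proof -
        interpret Xj: real_normed_space "X j" by (rule normed[OF j])
        show ?thesis
          using i j xc w_le[OF j] mem_comp[OF w j]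
          by (simp add: add_comp z_comp) (simp add: coord_def)
      qed
      then show ?thesis
        using add_mem[OF coord_mem[OF i xc(1)] z] by (simp add: unit_ball_def nrm_le_iff)
    qed
    moreover have "w i \<in> unit_ball (X i)"
      using wi w_le[OF i] by (simp add: unit_ball_def)
    ultimately show "\<exists>v\<in>unit_ball (X i). \<exists>z\<in>carrier W.
        w = coord i v \<oplus>\<^bsub>W\<^esub> z \<and> (\<forall>x\<in>unit_ball (X i). coord i x \<oplus>\<^bsub>W\<^esub> z \<in> unit_ball W)"
      using z w_eq by blast
  qed
qed

end

theorem proposition2p18:
  fixes \<Gamma> :: "'i set" and X :: "'i \<Rightarrow> 'a normed_module"
  assumes banach: "\<And>i. i \<in> \<Gamma> \<Longrightarrow> banach_space (X i)"
    and nontrivial: "\<And>i. i \<in> \<Gamma> \<Longrightarrow> carrier (X i) \<noteq> {\<zero>\<^bsub>X i\<^esub>}"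
  shows "(BDP (c0_sum \<Gamma> X) \<longrightarrow> (\<forall>i\<in>\<Gamma>. BDP (X i))) \<and>
         (BHP (c0_sum \<Gamma> X) \<longrightarrow> (\<forall>i\<in>\<Gamma>. BHP (X i))) \<and>
         (BSCSP (c0_sum \<Gamma> X) \<longrightarrow> (\<forall>i\<in>\<Gamma>. BSCSP (X i)))"
proof -
  interpret normed_family \<Gamma> X
    using banach by (auto intro: normed_family.intro banach_space.axioms(1))
  note emb = ball_translate_embedding_coord
  show ?thesis
    using ball_translate_embedding.BDP_pullback[OF emb _ nontrivial]
      ball_translate_embedding.BHP_pullback[OF emb]
      ball_translate_embedding.BSCSP_pullback[OF emb _ nontrivial]
    by blast
qed

end
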